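(* Let $C_+^{(3)}=\{(x_1,x_2)\in\mathbb{R}^2\colon |x_2|<\frac1{\sqrt3}x_1\}$. Uniformly in $x=(x_1,x_2)\in C_+^{(3)}$, $y=(y_1,y_2)\in C_+^{(3)}$, and $t>0$, $$ p_t^{\det,C_+^{(3)}}(x,y)\simeq \frac{x_1y_1}{x_1y_1+t}\cdot\frac{(x_1-\sqrt3x_2)(y_1-\sqrt3y_2)}{(x_1-\sqrt3x_2)(y_1-\sqrt3y_2)+t}\cdot\frac{(x_1+\sqrt3x_2)(y_1+\sqrt3y_2)}{(x_1+\sqrt3x_2)(y_1+\sqrt3y_2)+t}\;p_t^{(2)}(x-y). $$
   Context: $p_t^{(2)}(w)=(4\pi t)^{-1}\exp(-\|w\|^2/4t)$, $w\in\mathbb{R}^2$, is the Gauss-Weierstrass kernel. Identify $\mathbb{R}^2\simeq\mathbb{C}$. The dihedral root system $I_2(3)$ is $\{e^{i\pi j/3}\colon j=0,\dots,5\}$, and $W=W(I_2(3))\subset O(2)$ is the group (of order 6) generated by the orthogonal reflections in the lines perpendicular to the vectors of $I_2(3)$. The open cone $C_+^{(3)}=\{\rho e^{i\theta}\colon \rho>0,\ |\theta|<\pi/6\}=\{(x_1,x_2)\colon |x_2|<\frac1{\sqrt3}x_1\}$ is a Weyl chamber for $I_2(3)$. The kernel $p_t^{\det,C_+^{(3)}}$ is the Dirichlet heat kernel on $C_+^{(3)}$ (the integral kernel of $e^{t\Delta}$ with $\Delta$ the Dirichlet Laplacian on $C_+^{(3)}$); it is given, for $x,y\in C_+^{(3)}$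 and $t>0$, by $$p_t^{\det,C_+^{(3)}}(x,y)=\sum_{g\in W}\det(g)\,p_t^{(2)}(gx-y).$$ $X\simeq Y$ uniformly in the indicated variables means that there is a constant $C>0$, independent of $x,y,t$, with $C^{-1}Y\le X\le CY$. *)

theory Defs
  imports "HOL-Analysis.Analysis" "HOL-Algebra.Generated_Groups"
begin

text \<open>The group O(n), realised as maps on \<open>real ^ 'n\<close> under composition.\<close>

definition orthogonal_group :: "((real ^ 'n) \<Rightarrow> (real ^ 'n)) monoid" where
  "orthogonal_group =
     \<lparr>carrier = {g. orthogonal_transformation g}, monoid.mult = (\<circ>), one = id\<rparr>"

definition reflection :: "real ^ 'n \<Rightarrow> real ^ 'n \<Rightarrow> real ^ 'n" where
  "reflection \<alpha> x = x - (2 * (x \<bullet> \<alpha>) / (\<alpha> \<bullet> \<alpha>)) *\<^sub>R \<alpha>"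

definition reflection_group :: "(real ^ 'n) set \<Rightarrow> ((real ^ 'n) \<Rightarrow> (real ^ 'n)) set" where
  "reflection_group R = generate orthogonal_group (reflection ` R)"

text \<open>The plane is \<open>real ^ 2\<close>; the point \<open>e\<^sup>i\<^sup>\<theta>\<close> is the vector \<open>(cos \<theta>, sin \<theta>)\<close>.\<close>

definition root_system_I2_3 :: "(real ^ 2) set" where
  "root_system_I2_3 =
     {vector [cos (pi * real j / 3), sin (pi * real j / 3)] | j. j \<in> {0..5::nat}}"

definition W_I2_3 :: "((real ^ 2) \<Rightarrow> (real ^ 2)) set" where
  "W_I2_3 = reflection_group root_system_I2_3"

definition chamber_I2_3 :: "(real ^ 2) set" where
  "chamber_I2_3 = {x. \<bar>x $ 2\<bar> < (1 / sqrt 3) * x $ 1}"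

definition gauss_weierstrass :: "real \<Rightarrow> real ^ 2 \<Rightarrow> real" where
  "gauss_weierstrass t w = inverse (4 * pi * t) * exp (- (norm w)\<^sup>2 / (4 * t))"

text \<open>The Dirichlet heat kernel of the chamber, given by its reflection-sum formula. It is
  meant for \<open>t > 0\<close> and \<open>x\<close>, \<open>y\<close> in the chamber.\<close>

definition dirichlet_kernel_I2_3 :: "real \<Rightarrow> real ^ 2 \<Rightarrow> real ^ 2 \<Rightarrow> real" where
  "dirichlet_kernel_I2_3 t x y =
     (\<Sum>g\<in>W_I2_3. det (matrix g) * gauss_weierstrass t (g x - y))"

end

theory Submission
  imports Defs
begin

text \<open>
  Dividing the reflection sum by the Gaussian \<open>p\<^sub>t(x - y)\<close> leaves
  \<open>E = \<Sum>g. det g * exp (- (\<langle>x, y\<rangle> - \<langle>g x, y\<rangle>) / 2t)\<close>. Let \<open>\<alpha>\<close>, \<open>\<beta>\<close> be the unit normals of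
  the two walls, so that the third positive root is \<open>\<alpha> + \<beta>\<close>, and put
  \<open>A = \<langle>x,\<alpha>\<rangle>\<langle>y,\<alpha>\<rangle>/t\<close>, \<open>B = \<langle>x,\<beta>\<rangle>\<langle>y,\<beta>\<rangle>/t\<close>, \<open>C = \<langle>x,\<beta>\<rangle>\<langle>y,\<alpha>\<rangle>/t\<close>, \<open>D = \<langle>x,\<alpha>\<rangle>\<langle>y,\<beta>\<rangle>/t\<close>.
  The six exponents are minus \<open>0\<close>, \<open>A\<close>, \<open>B\<close>, \<open>A+B+C\<close>, \<open>A+B+D\<close>, \<open>A+B+C+D\<close>, and hence
  \<open>E = (1 - e\<^sup>-\<^sup>A)(1 - e\<^sup>-\<^sup>B) - e\<^sup>-\<^sup>A\<^sup>-\<^sup>B (1 - e\<^sup>-\<^sup>C)(1 - e\<^sup>-\<^sup>D)\<close>.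

  The two products can nearly coincide, as they do when \<open>A\<close>, \<open>B\<close>, \<open>C\<close>, \<open>D\<close> are all small, so
  the estimate is a question of cancellation. The cancellation is governed by the relation \<open>A B = C D\<close>. It allows one to pull out the first
  product:
  \<open>E = (1 - e\<^sup>-\<^sup>A)(1 - e\<^sup>-\<^sup>B) (1 - \<psi>(A) \<psi>(B) \<phi>(C) \<phi>(D))\<close> with \<open>\<phi>(z) = (1 - e\<^sup>-\<^sup>z)/z\<close> and
  \<open>\<psi>(z) = z/(e\<^sup>z - 1)\<close>. Both functions take values in \<open>(0, 1]\<close>, and both fall short of \<open>1\<close> by an
  amount comparable to \<open>z/(z+1)\<close>. A product of four numbers in \<open>[0, 1]\<close> falls short of \<open>1\<close> by an
  amount comparable to the sum of the four shortfalls, so the last factor is comparable to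
  \<open>S/(S+1)\<close> with \<open>S = A+B+C+D = x\<^sub>1 y\<^sub>1/t\<close>, while the first two are comparable to
  \<open>A/(A+1)\<close> and \<open>B/(B+1)\<close>. This is \<open>alternating_sum_bounds\<close>; the reduction to it is
  \<open>dirichlet_kernel_factorization\<close>, which rests on the explicit list of the six elements of
  the group in \<open>W_I2_3_eq\<close>.
\<close>

section \<open>The saturation function\<close>

text \<open>In the variable \<open>z = uv/t\<close>, every factor \<open>uv/(uv + t)\<close> of the claimed bound is this
  function, which is comparable to \<open>min 1 z\<close>.\<close>

definition sat :: "real \<Rightarrow> real" where
  "sat z = z / (z + 1)"

lemma sat_nonneg: "0 \<le> z \<Longrightarrow> 0 \<le> sat z"
  by (simp add: sat_def)

lemma sat_mono: "0 \<le> u \<Longrightarrow> u \<le> v \<Longrightarrow> sat u \<le> sat v"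
  by (simp add: sat_def field_simps)

lemma sat_add_le:
  assumes "0 \<le> u" "0 \<le> v"
  shows "sat (u + v) \<le> sat u + sat v"
proof -
  have "sat (u + v) = u / (u + v + 1) + v / (u + v + 1)"
    by (simp add: sat_def add_divide_distrib)
  also have "\<dots> \<le> sat u + sat v"
    unfolding sat_def using assms by (intro add_mono divide_left_mono mult_pos_pos) auto
  finally show ?thesis .
qed

lemma sat_mult_le:
  assumes "1 \<le> k" "0 \<le> z"
  shows "sat (k * z) \<le> k * sat z"
proof -
  have "z \<le> k * z"
    using mult_right_mono[OF assms] by simp
  then have "k * z / (k * z + 1) \<le> k * z / (z + 1)"
    using assms by (intro divide_left_mono mult_pos_pos) auto
  then show ?thesis
    by (simp add: sat_def)
qed

lemma divide_add_eq_sat: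
  assumes "0 < t"
  shows "z / (z + t) = sat (z / t)"
proof -
  have "z / t + 1 = (z + t) / t"
    using assms by (simp add: add_divide_distrib)
  then show ?thesis
    using assms by (simp add: sat_def)
qed

section \<open>Elementary exponential quotients\<close>

lemma one_minus_exp_bounds:
  assumes "0 \<le> z"
  shows "sat z \<le> 1 - exp (- z)" and "1 - exp (- z) \<le> 2 * sat z"
proof -
  have "exp (- z) \<le> 1 / (1 + z)"
    using exp_ge_add_one_self[of z] assms by (simp add: exp_minus field_simps)
  then show "sat z \<le> 1 - exp (- z)"
    using assms by (simp add: sat_def field_simps)
  have "1 - exp (- z) \<le> min 1 z"
    using exp_ge_add_one_self[of "- z"] by simp
  also have "\<dots> \<le> 2 * sat z"
    using assms mult_right_mono[of z 1 z]
    by (cases "z \<le> 1") (auto simp: sat_def field_simps)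
  finally show "1 - exp (- z) \<le> 2 * sat z" .
qed

text \<open>\<open>phi z\<close> is the mean of \<open>exp (- u)\<close> over \<open>0 \<le> u \<le> z\<close>, and \<open>psi z\<close> is the ratio of the
  smallest value \<open>exp (- z)\<close> to this mean. For this reason neither exceeds \<open>1\<close>, and both tend to
  \<open>1\<close> as \<open>z\<close> decreases to \<open>0\<close>.\<close>

definition phi :: "real \<Rightarrow> real" where
  "phi z = (1 - exp (- z)) / z"

definition psi :: "real \<Rightarrow> real" where
  "psi z = z / (exp z - 1)"

lemma one_minus_phi_bounds:
  assumes "0 < z"
  shows "sat z / 2 \<le> 1 - phi z" and "1 - phi z \<le> sat z"
proof -
  have "sat z / z \<le> phi z"
    unfolding phi_def using one_minus_exp_bounds(1)[of z] assms by (simp add: divide_right_mono)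
  moreover have "1 - sat z = sat z / z"
    using assms by (simp add: sat_def diff_divide_eq_iff)
  ultimately show "1 - phi z \<le> sat z" by simp
  \<comment> \<open>Cleared of denominators, the lower bound says that the following function is nonnegative.
    It vanishes at \<open>0\<close> and is increasing.\<close>
  define f where "f = (\<lambda>z::real. z\<^sup>2 / 2 - 1 + (1 + z) * exp (- z))"
  have "f 0 \<le> f z"
  proof (rule DERIV_nonneg_imp_nondecreasing[where a = 0 and b = z and f = f])
    show "0 \<le> z" using assms by simp
    fix u :: real assume u: "0 \<le> u" "u \<le> z"
    have "(f has_real_derivative u * (1 - exp (- u))) (at u)"
      unfolding f_def by (auto intro!: derivative_eq_intros simp: algebra_simps)
    moreover have "0 \<le> u * (1 - exp (- u))"
      using u by simp
    ultimately show "\<exists>y. (f has_real_derivative y) (at u) \<and> 0 \<le> y" by blast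
  qed
  then have "0 \<le> f z" by (simp add: f_def)
  moreover have "1 - phi z - sat z / 2 = f z / (z * (1 + z))"
    using assms by (simp add: f_def phi_def sat_def field_simps power2_eq_square)
  ultimately show "sat z / 2 \<le> 1 - phi z"
    using assms by (smt (verit) divide_nonneg_pos mult_pos_pos)
qed

lemma one_minus_psi_bounds:
  assumes "0 < z"
  shows "sat z / 2 \<le> 1 - psi z" and "1 - psi z \<le> 2 * sat z"
proof -
  have e: "1 + z + z\<^sup>2 / 2 \<le> exp z"
    using assms by (intro exp_lower_Taylor_quadratic) simp
  have "psi z \<le> z / (z + z\<^sup>2 / 2)"
    unfolding psi_def using assms e
    by (intro divide_left_mono mult_pos_pos) (auto intro: add_pos_nonneg simp: field_simps)
  also have "z + z\<^sup>2 / 2 = z * (1 + z / 2)"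
    by (simp add: power2_eq_square algebra_simps)
  also have "z / (z * (1 + z / 2)) = 1 / (1 + z / 2)"
    using assms by simp
  also have "\<dots> \<le> 1 - sat z / 2"
    using assms by (simp add: sat_def field_simps)
  finally show "sat z / 2 \<le> 1 - psi z" by simp
  have "exp (- z) \<le> psi z"
    using exp_ge_add_one_self[of "- z"] assms
    by (simp add: psi_def exp_minus field_simps)
  then show "1 - psi z \<le> 2 * sat z"
    using one_minus_exp_bounds(2)[of z] assms by simp
qed

lemma phi_psi_nonneg_le_1:
  assumes "0 < z"
  shows "0 \<le> phi z" "phi z \<le> 1" "0 \<le> psi z" "psi z \<le> 1"
proof -
  show "0 \<le> phi z" "0 \<le> psi z"
    using assms by (simp_all add: phi_def psi_def)
  show "phi z \<le> 1" "psi z \<le> 1"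
    using one_minus_phi_bounds(1)[OF assms] one_minus_psi_bounds(1)[OF assms]
      sat_nonneg[of z] assms by simp_all
qed

section \<open>The alternating exponential sum\<close>

lemma one_minus_prod4_bounds:
  fixes a b c d :: real
  assumes "a \<in> {0..1}" "b \<in> {0..1}" "c \<in> {0..1}" "d \<in> {0..1}"
  shows "1 - a * b * c * d \<le> (1 - a) + (1 - b) + (1 - c) + (1 - d)"
    and "(1 - a) + (1 - b) + (1 - c) + (1 - d) \<le> 4 * (1 - a * b * c * d)"
proof -
  have two: "u * v \<in> {0..1}" "u * v \<le> u" "u * v \<le> v" "1 - u * v \<le> (1 - u) + (1 - v)"
    if "u \<in> {0..1}" "v \<in> {0..1}" for u v :: real
  proof -
    show "u * v \<in> {0..1}" using that by (simp add: mult_le_one)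
    show "u * v \<le> u" "u * v \<le> v"
      using that by (simp_all add: mult_left_le mult_left_le_one_le)
    have "0 \<le> (1 - u) * (1 - v)" using that by simp
    then show "1 - u * v \<le> (1 - u) + (1 - v)" by (simp add: algebra_simps)
  qed
  note ab = two[OF assms(1,2)]
  note abc = two[OF ab(1) assms(3)]
  note abcd = two[OF abc(1) assms(4)]
  show "1 - a * b * c * d \<le> (1 - a) + (1 - b) + (1 - c) + (1 - d)"
    using ab(4) abc(4) abcd(4) by linarith
  show "(1 - a) + (1 - b) + (1 - c) + (1 - d) \<le> 4 * (1 - a * b * c * d)"
  proof -
    define p where "p = a * b * c * d"
    have "p \<le> a" "p \<le> b" "p \<le> c" "p \<le> d"
      unfolding p_def using ab(2,3) abc(2,3) abcd(2,3) by linarith+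
    then show ?thesis
      unfolding p_def[symmetric] by (simp add: right_diff_distrib)
  qed
qed

text \<open>The relation \<open>A B = C D\<close> enters only here, to trade the factor \<open>C D\<close> of
  \<open>(1 - e\<^sup>-\<^sup>C)(1 - e\<^sup>-\<^sup>D) = C D \<phi>(C) \<phi>(D)\<close> for \<open>A B\<close>, which \<open>e\<^sup>-\<^sup>A A = (1 - e\<^sup>-\<^sup>A) \<psi>(A)\<close> and its
  analogue for \<open>B\<close> then absorb.\<close>

lemma alternating_sum_factorization:
  fixes A B C D :: real
  assumes pos: "0 < A" "0 < B" "0 < C" "0 < D" and rel: "A * B = C * D"
  shows "1 - exp (- A) - exp (- B) + exp (- (A + B + C)) + exp (- (A + B + D))
           - exp (- (A + B + C + D))
         = (1 - exp (- A)) * (1 - exp (- B)) * (1 - psi A * psi B * phi C * phi D)"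
proof -
  have phi: "1 - exp (- z) = z * phi z" if "0 < z" for z
    using that by (simp add: phi_def)
  have psi: "exp (- z) * z = (1 - exp (- z)) * psi z" if "0 < z" for z
    using that by (simp add: psi_def exp_minus field_simps)
  have "exp (- A) * exp (- B) * ((1 - exp (- C)) * (1 - exp (- D)))
        = exp (- A) * exp (- B) * (C * D) * (phi C * phi D)"
    using pos by (simp add: phi)
  also have "\<dots> = (exp (- A) * A) * (exp (- B) * B) * (phi C * phi D)"
    by (simp add: rel[symmetric])
  also have "\<dots> = (1 - exp (- A)) * (1 - exp (- B)) * (psi A * psi B * phi C * phi D)"
    using pos by (simp add: psi)
  finally have *: "exp (- A) * exp (- B) * ((1 - exp (- C)) * (1 - exp (- D))) = \<dots>" .
  have "1 - exp (- A) - exp (- B) + exp (- (A + B + C)) + exp (- (A + B + D))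
          - exp (- (A + B + C + D))
        = (1 - exp (- A)) * (1 - exp (- B))
          - exp (- A) * exp (- B) * ((1 - exp (- C)) * (1 - exp (- D)))"
    by (simp add: exp_add exp_diff exp_minus field_simps)
  then show ?thesis
    unfolding * by (simp add: algebra_simps)
qed

lemma alternating_sum_bounds:
  fixes A B C D :: real
  assumes pos: "0 < A" "0 < B" "0 < C" "0 < D" and rel: "A * B = C * D"
  defines "E \<equiv> 1 - exp (- A) - exp (- B) + exp (- (A + B + C)) + exp (- (A + B + D))
             - exp (- (A + B + C + D))"
  shows "sat A * sat B * (sat (A + B + C + D) / 8) \<le> E"
    and "E \<le> (2 * sat A) * (2 * sat B) * (8 * sat (A + B + C + D))"
proof -
  define P where "P = psi A * psi B * phi C * phi D"
  let ?S = "A + B + C + D"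
  let ?defect = "(1 - psi A) + (1 - psi B) + (1 - phi C) + (1 - phi D)"
  have E: "E = (1 - exp (- A)) * (1 - exp (- B)) * (1 - P)"
    unfolding E_def P_def by (rule alternating_sum_factorization[OF pos rel])
  have "psi A \<in> {0..1}" "psi B \<in> {0..1}" "phi C \<in> {0..1}" "phi D \<in> {0..1}"
    using pos by (simp_all add: phi_psi_nonneg_le_1)
  note P = one_minus_prod4_bounds[OF this, folded P_def]
  have "sat ?S \<le> sat A + sat B + sat C + sat D"
    using sat_add_le[of "A + B + C" D] sat_add_le[of "A + B" C] sat_add_le[of A B] pos by simp
  then have lower: "sat ?S / 8 \<le> 1 - P"
    using one_minus_psi_bounds(1)[OF pos(1)] one_minus_psi_bounds(1)[OF pos(2)]
      one_minus_phi_bounds(1)[OF pos(3)] one_minus_phi_bounds(1)[OF pos(4)]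
      P(2)[unfolded right_diff_distrib]
    by linarith
  have "sat A \<le> sat ?S" "sat B \<le> sat ?S" "sat C \<le> sat ?S" "sat D \<le> sat ?S"
    using pos by (auto intro!: sat_mono)
  then have upper: "1 - P \<le> 8 * sat ?S"
    using one_minus_psi_bounds(2)[OF pos(1)] one_minus_psi_bounds(2)[OF pos(2)]
      one_minus_phi_bounds(2)[OF pos(3)] one_minus_phi_bounds(2)[OF pos(4)] P(1)
      sat_nonneg[of ?S] pos
    by linarith
  have nn: "0 \<le> sat A" "0 \<le> sat B" "0 \<le> sat ?S"
    using pos by (auto intro!: sat_nonneg)
  show "sat A * sat B * (sat ?S / 8) \<le> E"
    unfolding E using pos nn lower
    by (intro mult_mono one_minus_exp_bounds(1)) auto
  show "E \<le> (2 * sat A) * (2 * sat B) * (8 * sat ?S)"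
    unfolding E using pos nn upper lower
    by (intro mult_mono one_minus_exp_bounds(2)) auto
qed

section \<open>The six elements of the group\<close>

text \<open>Rotations (\<open>e = 1\<close>) and reflections (\<open>e = -1\<close>) of the plane in a common form, so that the
  elements of the group can be enumerated and multiplied through their parameters.\<close>

definition planar_map :: "real \<times> real \<times> real \<Rightarrow> real ^ 2 \<Rightarrow> real ^ 2" where
  "planar_map = (\<lambda>(e, c, s) x. vector [c * x$1 - e * s * x$2, s * x$1 + e * c * x$2])"

lemma planar_map_nth [simp]:
  "planar_map (e, c, s) x $ 1 = c * x$1 - e * s * x$2"
  "planar_map (e, c, s) x $ 2 = s * x$1 + e * c * x$2"
  by (simp_all add: planar_map_def)

lemma planar_map_comp:
  assumes "e * e = 1"
  shows "planar_map (e, c, s) \<circ> planar_map (e', c', s')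
         = planar_map (e * e', c * c' - e * s * s', s * c' + e * c * s')"
  using assms by (auto simp: fun_eq_iff vec_eq_iff forall_2 algebra_simps)

lemma planar_map_id: "planar_map (1, 1, 0) = id"
  by (auto simp: fun_eq_iff vec_eq_iff forall_2)

lemma planar_map_inj:
  assumes "c\<^sup>2 + s\<^sup>2 = 1" and "planar_map (e, c, s) = planar_map (e', c', s')"
  shows "(e, c, s) = (e', c', s')"
proof -
  have eq: "planar_map (e, c, s) (vector [a, b]) $ i = planar_map (e', c', s') (vector [a, b]) $ i"
    for a b i
    using assms(2) by simp
  have "c = c'" "s = s'"
    using eq[of 1 0 1] eq[of 1 0 2] by simp_all
  moreover from this have "e * s = e' * s" "e * c = e' * c"
    using eq[of 0 1 1] eq[of 0 1 2] by simp_all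
  then have "e = e'"
    using assms(1) by auto
  ultimately show ?thesis by simp
qed

lemma det_matrix_planar_map: "det (matrix (planar_map (e, c, s))) = e * (c\<^sup>2 + s\<^sup>2)"
  by (simp add: det_2 matrix_def axis_def power2_eq_square algebra_simps)

lemma linear_planar_map: "linear (planar_map p)"
  by (cases p) (auto intro!: linearI simp: vec_eq_iff forall_2 algebra_simps)

lemma norm_planar_map:
  assumes "c\<^sup>2 + s\<^sup>2 = 1" and "e\<^sup>2 = 1"
  shows "norm (planar_map (e, c, s) x) = norm x"
proof -
  have "planar_map (e, c, s) x \<bullet> planar_map (e, c, s) x
        = (c\<^sup>2 + s\<^sup>2) * (x$1)\<^sup>2 + e\<^sup>2 * (c\<^sup>2 + s\<^sup>2) * (x$2)\<^sup>2"
    by (simp add: inner_vec_def sum_2 power2_eq_square algebra_simps)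
  also have "\<dots> = x \<bullet> x"
    using assms by (simp add: inner_vec_def sum_2 power2_eq_square)
  finally show ?thesis by (simp add: norm_eq)
qed

definition rotation_params :: "(real \<times> real \<times> real) set" where
  "rotation_params = {(1, 1, 0), (1, - (1/2), sqrt 3 / 2), (1, - (1/2), - (sqrt 3 / 2))}"

definition reflection_params :: "(real \<times> real \<times> real) set" where
  "reflection_params = {(- 1, - 1, 0), (- 1, 1/2, - (sqrt 3 / 2)), (- 1, 1/2, sqrt 3 / 2)}"

lemmas params_defs = rotation_params_def reflection_params_def

lemma params_unit:
  assumes "(e, c, s) \<in> rotation_params \<union> reflection_params"
  shows "c\<^sup>2 + s\<^sup>2 = 1" and "e\<^sup>2 = 1"
proof -
  have "\<forall>(e, c, s) \<in> rotation_params \<union> reflection_params. c\<^sup>2 + s\<^sup>2 = 1 \<and> e\<^sup>2 = 1"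
    by (simp add: params_defs power_divide)
  from bspec[OF this assms] show "c\<^sup>2 + s\<^sup>2 = 1" and "e\<^sup>2 = 1"
    by simp_all
qed

lemma inj_on_planar_map: "inj_on planar_map (rotation_params \<union> reflection_params)"
  by (rule inj_onI) (metis params_unit(1) planar_map_inj prod_cases3)

lemma planar_map_params_comp:
  assumes "p \<in> rotation_params \<union> reflection_params" "q \<in> rotation_params \<union> reflection_params"
  shows "planar_map p \<circ> planar_map q \<in> planar_map ` (rotation_params \<union> reflection_params)"
proof -
  have "\<forall>(e, c, s) \<in> rotation_params \<union> reflection_params.
          \<forall>(e', c', s') \<in> rotation_params \<union> reflection_params.
            e * e = 1 \<and>
            (e * e', c * c' - e * s * s', s * c' + e * c * s') \<in> rotation_params \<union> reflection_params"
    by (simp add: params_defs)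
  with assms have "case p of (e, c, s) \<Rightarrow> case q of (e', c', s') \<Rightarrow> e * e = 1 \<and>
      (e * e', c * c' - e * s * s', s * c' + e * c * s') \<in> rotation_params \<union> reflection_params"
    by fast
  then show ?thesis
    by (cases p, cases q) (simp only: prod.case planar_map_comp imageI)
qed

text \<open>Opposite roots define the same reflection, so the six roots give three reflections.\<close>

lemma reflections_I2_3: "reflection ` root_system_I2_3 = planar_map ` reflection_params"
proof -
  have reflection_unit: "reflection (vector [cos \<theta>, sin \<theta>] :: real ^ 2)
              = planar_map (- 1, - cos (2 * \<theta>), - sin (2 * \<theta>))" for \<theta>
  proof
    fix x :: "real ^ 2"
    define v where "v = (vector [cos \<theta>, sin \<theta>] :: real ^ 2)"
    have "v \<bullet> v = 1"
      using sin_cos_squared_add[of \<theta>]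
      by (simp add: v_def inner_vec_def sum_2 power2_eq_square add.commute)
    then have v: "reflection v x = x - (2 * (x \<bullet> v)) *\<^sub>R v"
      by (simp add: reflection_def)
    have "reflection v x $ 1 = - cos (2 * \<theta>) * x$1 - sin (2 * \<theta>) * x$2"
      unfolding v cos_double_cos sin_double
      by (simp add: v_def inner_vec_def sum_2 power2_eq_square algebra_simps)
    moreover have "reflection v x $ 2 = - sin (2 * \<theta>) * x$1 + cos (2 * \<theta>) * x$2"
      unfolding v cos_double_sin sin_double
      by (simp add: v_def inner_vec_def sum_2 power2_eq_square algebra_simps)
    ultimately show "reflection (vector [cos \<theta>, sin \<theta>]) x
        = planar_map (- 1, - cos (2 * \<theta>), - sin (2 * \<theta>)) x"
      by (simp add: v_def[symmetric] vec_eq_iff forall_2)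
  qed
  have 4: "4 * pi / 3 = pi / 3 + pi" by simp
  have c: "cos (2 * pi / 3) = - (1/2)" "cos (4 * pi / 3) = - (1/2)"
    and s: "sin (2 * pi / 3) = sqrt 3 / 2" "sin (4 * pi / 3) = - (sqrt 3 / 2)"
    unfolding 4 cos_periodic_pi sin_periodic_pi by (simp_all add: cos_120 sin_120 cos_60 sin_60)
  define g where "g = (\<lambda>\<theta>::real. (- 1 :: real, - cos \<theta>, - sin \<theta>))"
  have g: "g (\<theta> + 2 * pi) = g \<theta>" for \<theta>
    by (simp add: g_def)
  have j: "{0..5::nat} = {0, 1, 2, 3, 4, 5}" by auto
  have roots: "root_system_I2_3
      = (\<lambda>j. vector [cos (pi * real j / 3), sin (pi * real j / 3)]) ` {0..5::nat}"
    unfolding root_system_I2_3_def by blast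
  have "reflection ` root_system_I2_3
      = (\<lambda>j. planar_map (g (2 * (pi * real j / 3)))) ` {0..5::nat}"
    unfolding roots image_image reflection_unit g_def by (rule refl)
  also have "\<dots> = planar_map ` {g 0, g (2 * pi / 3), g (4 * pi / 3), g (0 + 2 * pi),
      g (2 * pi / 3 + 2 * pi), g (4 * pi / 3 + 2 * pi)}"
    unfolding j by (simp add: field_simps)
  also have "\<dots> = planar_map ` reflection_params"
    unfolding g by (auto simp: g_def c s reflection_params_def)
  finally show ?thesis .
qed

lemma monoid_orthogonal_group: "monoid orthogonal_group"
  by (rule monoidI)
    (auto simp: orthogonal_group_def orthogonal_transformation_compose
      orthogonal_transformation_id comp_assoc id_def)

lemma W_I2_3_eq: "W_I2_3 = planar_map ` (rotation_params \<union> reflection_params)"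
proof
  let ?G = "orthogonal_group :: ((real ^ 2) \<Rightarrow> (real ^ 2)) monoid"
  let ?K = "planar_map ` (rotation_params \<union> reflection_params)"
  let ?R = "planar_map ` reflection_params"
  have W: "W_I2_3 = generate ?G ?R"
    by (simp add: W_I2_3_def reflection_group_def reflections_I2_3)
  have mult: "h \<otimes>\<^bsub>?G\<^esub> k = h \<circ> k" and one_eq: "\<one>\<^bsub>?G\<^esub> = id" for h k
    by (simp_all add: orthogonal_group_def)
  have inv_eq: "inv\<^bsub>?G\<^esub> h = h" if h_in: "h \<in> ?R" for h
  proof -
    obtain p where "h = planar_map p" "p \<in> reflection_params"
      using h_in by blast
    then obtain e c s where h: "h = planar_map (e, c, s)" and p: "(e, c, s) \<in> reflection_params"
      by (cases p) simp
    have unit: "c\<^sup>2 + s\<^sup>2 = 1" "e\<^sup>2 = 1"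
      using p params_unit[of e c s] by auto
    have "e = - 1"
      using p by (auto simp: reflection_params_def)
    then have "h \<circ> h = id"
      using unit(1) by (simp add: h planar_map_comp planar_map_id power2_eq_square)
    moreover have "h \<in> carrier ?G"
      using unit
      by (auto simp: h orthogonal_group_def orthogonal_transformation linear_planar_map
          norm_planar_map)
    ultimately show ?thesis
      using monoid.inv_unique'[OF monoid_orthogonal_group, of h h] by (simp add: mult one_eq)
  qed
  show "W_I2_3 \<subseteq> ?K"
  proof
    fix h assume "h \<in> W_I2_3"
    then have "h \<in> generate ?G ?R" by (simp add: W)
    then show "h \<in> ?K"
    proof induction
      case one
      have "(1, 1, 0) \<in> rotation_params" by (simp add: rotation_params_def)
      then show ?case unfolding one_eq planar_map_id[symmetric] by blast
    next
      case (incl h)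
      then show ?case by auto
    next
      case (inv h)
      then show ?case by (auto simp: inv_eq)
    next
      case (eng h1 h2)
      then show ?case unfolding mult using planar_map_params_comp by blast
    qed
  qed
  have R: "?R \<subseteq> W_I2_3"
    unfolding W by (auto intro: generate.incl)
  have comp: "h \<circ> k \<in> W_I2_3" if "h \<in> W_I2_3" "k \<in> W_I2_3" for h k
    using generate.eng[of h ?G ?R k] that by (simp add: W mult)
  \<comment> \<open>Each rotation is a product of the reflection in the axis \<open>x\<^sub>1 = 0\<close> with some reflection.\<close>
  have "planar_map p \<in> W_I2_3" if p: "p \<in> rotation_params" for p
  proof -
    obtain c s where p_eq: "p = (1, c, s)"
      using p by (auto simp: rotation_params_def)
    have q: "(- 1, - c, - s) \<in> reflection_params"
      using p unfolding p_eq by (auto simp: params_defs)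
    have "planar_map (- 1, - c, - s) \<circ> planar_map (- 1, - 1, 0) = planar_map p"
      by (simp add: planar_map_comp p_eq)
    moreover have "(- 1, - 1, 0) \<in> reflection_params"
      by (simp add: reflection_params_def)
    ultimately show ?thesis
      using comp q R by (metis imageI subsetD)
  qed
  with R show "?K \<subseteq> W_I2_3" by auto
qed

section \<open>The kernel in simple-root coordinates\<close>

text \<open>Moving \<open>x\<close> by a norm-preserving map changes \<open>\<parallel>x - y\<parallel>\<^sup>2\<close> only through the inner product.\<close>

lemma gauss_weierstrass_isometry:
  assumes "norm (g x) = norm x"
  shows "gauss_weierstrass t (g x - y)
         = gauss_weierstrass t (x - y) * exp (- (x \<bullet> y - g x \<bullet> y) / (2 * t))"
proof -
  have "(norm (g x - y))\<^sup>2 = (norm (x - y))\<^sup>2 + 2 * (x \<bullet> y - g x \<bullet> y)"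
    using assms unfolding norm_eq
    by (simp add: power2_norm_eq_inner inner_diff_left inner_diff_right inner_commute)
  then have "- (norm (g x - y))\<^sup>2 / (4 * t)
      = - (norm (x - y))\<^sup>2 / (4 * t) + - (x \<bullet> y - g x \<bullet> y) / (2 * t)"
    by (simp add: diff_divide_distrib add_divide_distrib)
  then show ?thesis
    by (simp only: gauss_weierstrass_def exp_add mult.assoc)
qed

text \<open>The unit normals of the walls are \<open>\<alpha> = (1/2, \<surd>3/2)\<close> and \<open>\<beta> = (1/2, -\<surd>3/2)\<close>, with
  \<open>\<langle>\<alpha>, \<beta>\<rangle> = -1/2\<close>. The reflection in a unit root \<open>\<gamma>\<close> lowers \<open>\<langle>x, y\<rangle>\<close> by
  \<open>2 \<langle>x, \<gamma>\<rangle> \<langle>y, \<gamma>\<rangle>\<close>, which gives the exponents \<open>A\<close>, \<open>B\<close> and, for \<open>\<gamma> = \<alpha> + \<beta>\<close>,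
  \<open>A + B + C + D\<close>; the two rotations, as products of the reflections in \<open>\<alpha>\<close> and \<open>\<beta>\<close>, give the
  two exponents with three terms.\<close>

lemma dirichlet_kernel_factorization:
  fixes x y :: "real ^ 2" and t :: real
  assumes "0 < t"
  defines "A \<equiv> (x$1 + sqrt 3 * x$2) * (y$1 + sqrt 3 * y$2) / (4 * t)"
    and "B \<equiv> (x$1 - sqrt 3 * x$2) * (y$1 - sqrt 3 * y$2) / (4 * t)"
    and "C \<equiv> (x$1 - sqrt 3 * x$2) * (y$1 + sqrt 3 * y$2) / (4 * t)"
    and "D \<equiv> (x$1 + sqrt 3 * x$2) * (y$1 - sqrt 3 * y$2) / (4 * t)"
  shows "dirichlet_kernel_I2_3 t x y = gauss_weierstrass t (x - y) *
           (1 - exp (- A) - exp (- B) + exp (- (A + B + C)) + exp (- (A + B + D))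
             - exp (- (A + B + C + D)))"
proof -
  let ?P = "rotation_params \<union> reflection_params"
  define X where "X = (\<lambda>p. exp (- (x \<bullet> y - planar_map p x \<bullet> y) / (2 * t)))"
  have summand: "det (matrix (planar_map p)) * gauss_weierstrass t (planar_map p x - y)
      = gauss_weierstrass t (x - y) * (fst p * X p)" if "p \<in> ?P" for p
  proof -
    obtain e c s where p: "p = (e, c, s)" by (cases p)
    show ?thesis
      using that params_unit[of e c s] unfolding p X_def
      by (simp add: det_matrix_planar_map gauss_weierstrass_isometry norm_planar_map)
  qed
  have X: "X (1, 1, 0) = 1" "X (- 1, 1/2, - (sqrt 3 / 2)) = exp (- A)"
    "X (- 1, 1/2, sqrt 3 / 2) = exp (- B)"
    "X (1, - (1/2), sqrt 3 / 2) = exp (- (A + B + D))"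
    "X (1, - (1/2), - (sqrt 3 / 2)) = exp (- (A + B + C))"
    "X (- 1, - 1, 0) = exp (- (A + B + C + D))"
    using assms(1)
    by (simp_all add: X_def A_def B_def C_def D_def inner_vec_def sum_2 field_simps)
  have "dirichlet_kernel_I2_3 t x y
      = (\<Sum>p\<in>?P. gauss_weierstrass t (x - y) * (fst p * X p))"
    unfolding dirichlet_kernel_I2_3_def W_I2_3_eq
    by (simp add: sum.reindex[OF inj_on_planar_map] summand)
  also have "\<dots> = gauss_weierstrass t (x - y) * (\<Sum>p\<in>?P. fst p * X p)"
    by (simp add: sum_distrib_left)
  also have "(\<Sum>p\<in>?P. fst p * X p)
      = 1 - exp (- A) - exp (- B) + exp (- (A + B + C)) + exp (- (A + B + D))
        - exp (- (A + B + C + D))"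
    unfolding params_defs by (simp add: X del: minus_add_distrib)
  finally show ?thesis .
qed

lemma chamber_I2_3_pos:
  assumes "x \<in> chamber_I2_3"
  shows "0 < x$1 + sqrt 3 * x$2" "0 < x$1 - sqrt 3 * x$2"
proof -
  have "\<bar>sqrt 3 * x$2\<bar> < x$1"
    using assms by (simp add: chamber_I2_3_def abs_mult field_simps)
  then show "0 < x$1 + sqrt 3 * x$2" "0 < x$1 - sqrt 3 * x$2"
    by linarith+
qed

theorem theorem1p2:
  shows "\<exists>C::real. C > 0 \<and>
    (\<forall>x \<in> chamber_I2_3. \<forall>y \<in> chamber_I2_3. \<forall>t::real. t > 0 \<longrightarrow>
      (let Y =
          (x$1 * y$1) / (x$1 * y$1 + t)
          * (((x$1 - sqrt 3 * x$2) * (y$1 - sqrt 3 * y$2))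
             / ((x$1 - sqrt 3 * x$2) * (y$1 - sqrt 3 * y$2) + t))
          * (((x$1 + sqrt 3 * x$2) * (y$1 + sqrt 3 * y$2))
             / ((x$1 + sqrt 3 * x$2) * (y$1 + sqrt 3 * y$2) + t))
          * gauss_weierstrass t (x - y)
       in inverse C * Y \<le> dirichlet_kernel_I2_3 t x y \<and>
          dirichlet_kernel_I2_3 t x y \<le> C * Y))"
proof (intro exI conjI ballI allI impI)
  \<comment> \<open>The constant is \<open>4 * 4 * 8\<close>: the lower bound \<open>1/8\<close> for the alternating sum, and a loss of
    \<open>4\<close> in each wall factor, whose normal in the claim has length \<open>2\<close> instead of \<open>1\<close>.\<close>
  show "(0::real) < 128" by simp
next
  fix x y :: "real ^ 2" and t :: real
  assume x: "x \<in> chamber_I2_3" and y: "y \<in> chamber_I2_3" and t: "0 < t"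
  define A where "A = (x$1 + sqrt 3 * x$2) * (y$1 + sqrt 3 * y$2) / (4 * t)"
  define B where "B = (x$1 - sqrt 3 * x$2) * (y$1 - sqrt 3 * y$2) / (4 * t)"
  define C where "C = (x$1 - sqrt 3 * x$2) * (y$1 + sqrt 3 * y$2) / (4 * t)"
  define D where "D = (x$1 + sqrt 3 * x$2) * (y$1 - sqrt 3 * y$2) / (4 * t)"
  define S where "S = A + B + C + D"
  define E where "E = 1 - exp (- A) - exp (- B) + exp (- (A + B + C)) + exp (- (A + B + D))
             - exp (- (A + B + C + D))"
  define G where "G = gauss_weierstrass t (x - y)"
  have pos: "0 < A" "0 < B" "0 < C" "0 < D"
    using chamber_I2_3_pos[OF x] chamber_I2_3_pos[OF y] t
    by (simp_all add: A_def B_def C_def D_def)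
  have rel: "A * B = C * D"
    by (simp add: A_def B_def C_def D_def)
  have S: "S = x$1 * y$1 / t"
    using t by (simp add: S_def A_def B_def C_def D_def field_simps)
  have "0 \<le> G"
    using t by (simp add: G_def gauss_weierstrass_def)
  have kernel: "dirichlet_kernel_I2_3 t x y = E * G"
    unfolding dirichlet_kernel_factorization[OF t] E_def A_def B_def C_def D_def G_def
    by (simp only: mult.commute)
  note E = alternating_sum_bounds[OF pos rel, folded E_def S_def]
  have nn: "0 \<le> sat A" "0 \<le> sat B" "0 \<le> sat S" "0 \<le> sat (4 * A)" "0 \<le> sat (4 * B)"
    using pos by (simp_all add: sat_nonneg S_def)
  have "sat S * sat (4 * B) * sat (4 * A) \<le> sat S * (4 * sat B) * (4 * sat A)"
    using pos nn by (intro mult_mono sat_mult_le) auto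
  also have "\<dots> \<le> 128 * E"
    using E(1) by simp
  finally have lower: "inverse 128 * (sat S * sat (4 * B) * sat (4 * A)) \<le> E"
    by simp
  have "E \<le> 32 * (sat S * sat B * sat A)"
    using E(2) by (simp add: algebra_simps)
  also have "\<dots> \<le> 128 * (sat S * sat (4 * B) * sat (4 * A))"
    using pos nn by (intro mult_mono sat_mono) (auto simp: S_def)
  finally have upper: "E \<le> 128 * (sat S * sat (4 * B) * sat (4 * A))" .
  have factors: "x$1 * y$1 / (x$1 * y$1 + t) = sat S"
    "(x$1 - sqrt 3 * x$2) * (y$1 - sqrt 3 * y$2)
       / ((x$1 - sqrt 3 * x$2) * (y$1 - sqrt 3 * y$2) + t) = sat (4 * B)"
    "(x$1 + sqrt 3 * x$2) * (y$1 + sqrt 3 * y$2)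
       / ((x$1 + sqrt 3 * x$2) * (y$1 + sqrt 3 * y$2) + t) = sat (4 * A)"
    unfolding divide_add_eq_sat[OF t] by (simp_all add: S A_def B_def)
  show "let Y =
          (x$1 * y$1) / (x$1 * y$1 + t)
          * (((x$1 - sqrt 3 * x$2) * (y$1 - sqrt 3 * y$2))
             / ((x$1 - sqrt 3 * x$2) * (y$1 - sqrt 3 * y$2) + t))
          * (((x$1 + sqrt 3 * x$2) * (y$1 + sqrt 3 * y$2))
             / ((x$1 + sqrt 3 * x$2) * (y$1 + sqrt 3 * y$2) + t))
          * gauss_weierstrass t (x - y)
       in inverse 128 * Y \<le> dirichlet_kernel_I2_3 t x y \<and>
          dirichlet_kernel_I2_3 t x y \<le> 128 * Y"
    unfolding factors kernel Let_def G_def[symmetric]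
    using mult_right_mono[OF lower \<open>0 \<le> G\<close>] mult_right_mono[OF upper \<open>0 \<le> G\<close>]
    by (simp add: mult.assoc)
qed

end
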